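(* Let $A\in\mathbb{R}^{N\times N}$, $C\in\mathbb{R}^{M\times N}$ with $(C,A)$ observable, and let $Q\in\mathbb{R}^{N\times N}$, $R\in\mathbb{R}^{M\times M}$ be symmetric positive definite. The family of invariant distributions $\{\mu^{\overline{\gamma}}\}$ converges weakly to the Dirac measure $\delta_{P^\ast}$ as $\overline{\gamma}\uparrow1$, i.e. $$\lim_{\overline{\gamma}\uparrow 1}d_P\left(\mu^{\overline{\gamma}},\delta_{P^\ast}\right)=0 .$$ Moreover, for every $\varepsilon>0$, $$\limsup_{\overline{\gamma}\uparrow 1}\left(-\frac{\ln \mu^{\overline{\gamma}}\left(B_\varepsilon^{C}(P^\ast)\right)}{\ln(1-\overline{\gamma})}\right)\le -1 .$$
   Context: $\mathbb{S}_+^N$ is the set of real symmetric positive semidefinite $N\times N$ matrices with the metric induced by the spectral norm $\|\cdot\|$. Define $f_0,f_1:\mathbb{S}_+^N\to\mathbb{S}_+^N$ by $f_0(X)=AXA^T+Q$ and $f_1(X)=AXA^T+Q-AXC^T(CXC^T+R)^{-1}CXA^T$. $P^\ast$ is the unique fixed point of $f_1$ in $\mathbb{S}_+^N$. For $\overline{\gamma}\in(0,1)$, let $\{\gamma_t\}_{t\ge0}$ be i.i.d. Bernoulli with $\mathbb{P}(\gamma_t=1)=\overline{\gamma}$ and consider the Markov chain $P_{t+1}=f_{\gamma_t}(P_t)$ on $\mathbb{S}_+^N$; $\mu^{\overline{\gamma}}$ is its unique invariant probability measure, to which the law of $P_t$ converges weakly from every initial $P_0\in\mathbb{S}_+^N$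 (such a measure exists and is unique under the stated hypotheses). $B_\varepsilon^C(P^\ast)=\{X\in\mathbb{S}_+^N\mid\|X-P^\ast\|\ge\varepsilon\}$ is the complement of the open ball. $d_P$ is the Prohorov metric on probability measures on $\mathbb{S}_+^N$: $d_P(\mu_1,\mu_2)=\inf\{\varepsilon>0\mid \mu_1(\mathcal{F})\le\mu_2(\mathcal{F}_\varepsilon)+\varepsilon\ \text{for all closed } \mathcal{F}\}$, with $\mathcal{F}_\varepsilon=\{Y\mid\inf_{X\in\mathcal{F}}\|Y-X\|<\varepsilon\}$. Convention: $\ln0=-\infty$. *)

theory Defs
  imports "HOL-Probability.Probability"
begin

definition pos_semidef :: "real^'n^'n \<Rightarrow> bool" where
  "pos_semidef X \<longleftrightarrow> transpose X = X \<and> (\<forall>v. 0 \<le> v \<bullet> (X *v v))"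

definition pos_def :: "real^'n^'n \<Rightarrow> bool" where
  "pos_def X \<longleftrightarrow> transpose X = X \<and> (\<forall>v. v \<noteq> 0 \<longrightarrow> 0 < v \<bullet> (X *v v))"

definition psd_cone :: "(real^'n^'n) set" where
  "psd_cone = {X. pos_semidef X}"

definition spectral_norm :: "real^'n^'m \<Rightarrow> real" where
  "spectral_norm X = onorm ((*v) X)"

(* The power operator on vec types is not the matrix power. *)
definition mat_pow :: "real^'n^'n \<Rightarrow> nat \<Rightarrow> real^'n^'n" where
  "mat_pow A k = ((**) A ^^ k) (mat 1)"

(* The observability matrix, with blocks C, CA, ..., C A^(N-1) stacked vertically,
   has (row) rank N. *)
definition observable :: "real^'n^'m \<Rightarrow> real^'n^'n \<Rightarrow> bool" where
  "observable C A \<longleftrightarrow> dim (\<Union>k<CARD('n). rows (C ** mat_pow A k)) = CARD('n)"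

definition f0 :: "real^'n^'n \<Rightarrow> real^'n^'n \<Rightarrow> real^'n^'n \<Rightarrow> real^'n^'n" where
  "f0 A Q X = A ** X ** transpose A + Q"

definition f1 :: "real^'n^'n \<Rightarrow> real^'n^'m \<Rightarrow> real^'n^'n \<Rightarrow> real^'m^'m
    \<Rightarrow> real^'n^'n \<Rightarrow> real^'n^'n" where
  "f1 A C Q R X = A ** X ** transpose A + Q
     - A ** X ** transpose C ** matrix_inv (C ** X ** transpose C + R) ** C ** X ** transpose A"

(* In finite dimension the spectral norm induces the standard topology, hence the
   standard Borel sets. *)
definition psd_borel :: "(real^'n^'n) measure" where
  "psd_borel = restrict_space borel psd_cone"

definition riccati_kernel :: "real^'n^'n \<Rightarrow> real^'n^'m \<Rightarrow> real^'n^'n \<Rightarrow> real^'m^'m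
    \<Rightarrow> real \<Rightarrow> real^'n^'n \<Rightarrow> (real^'n^'n) measure" where
  "riccati_kernel A C Q R g X =
     distr (measure_pmf (bernoulli_pmf g)) psd_borel (\<lambda>b. if b then f1 A C Q R X else f0 A Q X)"

definition invariant_distribution :: "real^'n^'n \<Rightarrow> real^'n^'m \<Rightarrow> real^'n^'n \<Rightarrow> real^'m^'m
    \<Rightarrow> real \<Rightarrow> (real^'n^'n) measure \<Rightarrow> bool" where
  "invariant_distribution A C Q R g \<nu> \<longleftrightarrow>
     prob_space \<nu> \<and> sets \<nu> = sets psd_borel \<and>
     (\<forall>B \<in> sets psd_borel. emeasure \<nu> B = (\<integral>\<^sup>+X. emeasure (riccati_kernel A C Q R g X) B \<partial>\<nu>))"

(* The infimum is taken in ereal, so that it is infinite for empty F. *)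
definition psd_nbhd :: "(real^'n^'n) set \<Rightarrow> real \<Rightarrow> (real^'n^'n) set" where
  "psd_nbhd F \<epsilon> = {Y \<in> psd_cone. (INF X\<in>F. ereal (spectral_norm (Y - X))) < ereal \<epsilon>}"

definition prohorov_dist :: "(real^'n^'n) measure \<Rightarrow> (real^'n^'n) measure \<Rightarrow> real" where
  "prohorov_dist \<mu>1 \<mu>2 = Inf {\<epsilon>. 0 < \<epsilon> \<and>
     (\<forall>F. closedin (top_of_set psd_cone) F \<longrightarrow> measure \<mu>1 F \<le> measure \<mu>2 (psd_nbhd F \<epsilon>) + \<epsilon>)}"

definition ball_compl :: "real \<Rightarrow> real^'n^'n \<Rightarrow> (real^'n^'n) set" where
  "ball_compl \<epsilon> P = {X \<in> psd_cone. \<epsilon> \<le> spectral_norm (X - P)}"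

(* On reals the library has ln 0 = 0. *)
definition eln :: "real \<Rightarrow> ereal" where
  "eln x = (if x = 0 then - \<infinity> else ereal (ln x))"

end

theory Submission
  imports Defs "HOL-Real_Asymp.Real_Asymp"
begin

text \<open>
  The quadratic form of \<open>f\<^sub>1(X)\<close> at \<open>v\<close> is the minimum over \<open>u\<close> of
  \<open>(A\<^sup>T v - C\<^sup>T u)\<^sup>T X (A\<^sup>T v - C\<^sup>T u) + v\<^sup>T Q v + u\<^sup>T R u\<close>.
  By observability every \<open>v\<close> can be steered to \<open>0\<close> in \<open>N\<close> steps, so after \<open>N\<close> measurement updates
  \<open>X\<close> is bounded by a multiple of \<open>P\<^sup>*\<close> that does not depend on the starting point; and if
  \<open>(1 - e) P\<^sup>* \<le> X \<le> (1 + e) P\<^sup>*\<close>, then each further update shrinks \<open>e\<close> by the factor \<open>1 - d\<close>, where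
  \<open>d P\<^sup>* \<le> Q\<close>. Hence some \<open>k\<close>, uniform in the starting point, consecutive updates enter the \<open>\<epsilon>\<close>-ball
  around \<open>P\<^sup>*\<close>. Under the invariant law the complement of the ball therefore has mass at most the
  probability \<open>O(1 - g)\<close> that one of a bounded number of measurements is lost. To use
  invariance one only needs, at each single step, measurable sets \<open>B\<close>, \<open>B'\<close> such that
  \<open>f\<^sub>1(X) \<in> B\<close> implies \<open>X \<in> B'\<close>, so no regularity of \<open>f\<^sub>1\<close> enters.
\<close>

section \<open>Quadratic forms and the spectral norm\<close>

abbreviation quad :: "real^'n^'n \<Rightarrow> real^'n \<Rightarrow> real" where
  "quad X v \<equiv> v \<bullet> (X *v v)"

lemma transpose_eq_iff_inner:
  fixes X :: "real^'n^'n"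
  shows "transpose X = X \<longleftrightarrow> (\<forall>u v. u \<bullet> (X *v v) = v \<bullet> (X *v u))"
proof -
  have "transpose X = X \<longleftrightarrow> (\<forall>u. transpose X *v u = X *v u)"
    by (simp only: matrix_eq)
  also have "\<dots> \<longleftrightarrow> (\<forall>u v. (u v* X) \<bullet> v = (X *v u) \<bullet> v)"
    by (simp add: vector_eq_rdot)
  finally show ?thesis
    by (simp add: dot_lmul_matrix inner_commute[of "X *v _"])
qed

lemma quad_add:
  fixes X :: "real^'n^'n"
  assumes "transpose X = X"
  shows "quad X (u + v) = quad X u + 2 * (u \<bullet> (X *v v)) + quad X v"
  using assms by (simp add: transpose_eq_iff_inner matrix_vector_right_distrib inner_simps)

lemma quad_diff:
  fixes X :: "real^'n^'n"
  assumes "transpose X = X"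
  shows "quad X (u - v) = quad X u - 2 * (u \<bullet> (X *v v)) + quad X v"
  using assms by (simp add: transpose_eq_iff_inner matrix_vector_mult_diff_distrib inner_simps)

lemma quad_scaleR: "quad X (c *\<^sub>R v) = c\<^sup>2 * quad (X :: real^'n^'n) v"
  by (simp add: matrix_vector_mult_scaleR power2_eq_square)

lemma pos_def_imp_pos_semidef: "pos_def X \<Longrightarrow> pos_semidef X"
  unfolding pos_def_def pos_semidef_def by (metis inner_zero_left less_eq_real_def)

lemma quad_add_le:
  assumes "pos_semidef X"
  shows "quad X (u + v) \<le> 2 * quad X u + 2 * quad X v"
proof -
  have "0 \<le> quad X (u - v)"
    using assms unfolding pos_semidef_def by blast
  then show ?thesis
    using assms by (simp add: pos_semidef_def quad_add quad_diff)
qed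

text \<open>Iterating the two-term bound doubles the constant with each summand; any finite constant
  is good enough later.\<close>

lemma quad_sum_le:
  assumes "pos_semidef X" "finite F"
  shows "quad X (\<Sum>i\<in>F. x i) \<le> 2 ^ card F * (\<Sum>i\<in>F. quad X (x i))"
  using assms(2)
proof (induction F rule: finite_induct)
  case (insert i F)
  have nn: "0 \<le> quad X v" for v
    using assms(1) unfolding pos_semidef_def by blast
  have "quad X (\<Sum>i\<in>insert i F. x i) \<le> 2 * quad X (x i) + 2 * quad X (\<Sum>i\<in>F. x i)"
    using quad_add_le[OF assms(1)] insert.hyps by simp
  also have "\<dots> \<le> 2 * quad X (x i) + 2 * (2 ^ card F * (\<Sum>i\<in>F. quad X (x i)))"
    using insert.IH by simp
  also have "2 * quad X (x i) \<le> 2 * 2 ^ card F * quad X (x i)"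
    using nn[of "x i"] mult_right_mono[of 1 "2 ^ card F" "quad X (x i)"] by simp
  finally show ?case
    using insert.hyps by (simp add: algebra_simps)
qed simp

text \<open>The form attains a positive minimum on the compact unit sphere, and homogeneity extends
  the bound to all vectors.\<close>

lemma pos_def_coercive:
  fixes X :: "real^'n^'n"
  assumes "pos_def X"
  obtains a where "0 < a" "\<And>v. a * (norm v)\<^sup>2 \<le> quad X v"
proof -
  have "continuous_on (sphere 0 1) (quad X)"
    by (intro continuous_intros linear_continuous_on matrix_vector_mul_bounded_linear)
  moreover obtain e :: "real^'n" where "norm e = 1"
    using vector_choose_size[of 1] by auto
  ultimately obtain w where w: "w \<in> sphere 0 1" "\<And>v. v \<in> sphere 0 1 \<Longrightarrow> quad X w \<le> quad X v"
    using continuous_attains_inf[of "sphere 0 1" "quad X"] by (metis compact_sphere empty_iff mem_sphere_0)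
  show thesis
  proof
    show "0 < quad X w"
    proof -
      have "w \<noteq> 0"
        using w(1) by auto
      then show ?thesis
        using assms unfolding pos_def_def by blast
    qed
    show "quad X w * (norm v)\<^sup>2 \<le> quad X v" for v
    proof (cases "v = 0")
      case False
      have "quad X v = (norm v)\<^sup>2 * quad X (v /\<^sub>R norm v)"
        using False quad_scaleR[of "norm v" "v /\<^sub>R norm v" X] by simp
      moreover have "quad X w \<le> quad X (v /\<^sub>R norm v)"
        using False by (intro w(2)) simp
      ultimately show ?thesis
        by (metis mult.commute mult_left_mono zero_le_power2)
    qed simp
  qed
qed

lemma quad_le_norm:
  fixes X :: "real^'n^'n"
  shows "quad X v \<le> spectral_norm X * (norm v)\<^sup>2"
proof -
  have "quad X v \<le> norm v * norm (X *v v)"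
    by (rule norm_cauchy_schwarz)
  also have "\<dots> \<le> norm v * (spectral_norm X * norm v)"
    unfolding spectral_norm_def
    by (intro mult_left_mono onorm matrix_vector_mul_bounded_linear) simp
  finally show ?thesis
    by (simp add: power2_eq_square mult_ac)
qed

lemma spectral_norm_nonneg: "0 \<le> spectral_norm X"
  unfolding spectral_norm_def by (rule onorm_pos_le[OF matrix_vector_mul_bounded_linear])

text \<open>Polarization: for symmetric \<open>D\<close> the bilinear form, and with it the operator
  norm, is controlled by values of the quadratic form.\<close>

lemma spectral_norm_le_quad:
  fixes D :: "real^'n^'n"
  assumes sym: "transpose D = D" and "0 \<le> c" and q: "\<And>v. \<bar>quad D v\<bar> \<le> c * (norm v)\<^sup>2"
  shows "spectral_norm D \<le> c"
  unfolding spectral_norm_def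
proof (rule onorm_le)
  fix v
  show "norm (D *v v) \<le> c * norm v"
  proof (cases "D *v v = 0")
    case False
    then have "v \<noteq> 0" by auto
    \<comment> \<open>\<open>D *v v\<close> rescaled to the length of \<open>v\<close>: pairing it
      with \<open>D *v v\<close> yields the full norm, and the parallelogram law produces a factor 4
      on both sides.\<close>
    define u where "u = (norm v / norm (D *v v)) *\<^sub>R (D *v v)"
    have nu: "norm u = norm v"
      using False by (simp add: u_def)
    have "4 * (u \<bullet> (D *v v)) = quad D (u + v) - quad D (u - v)"
      by (simp add: quad_add[OF sym] quad_diff[OF sym])
    also have "\<dots> \<le> c * (norm (u + v))\<^sup>2 + c * (norm (u - v))\<^sup>2"
      using q[of "u + v"] q[of "u - v"] by linarith
    also have "\<dots> = c * (4 * (norm v)\<^sup>2)"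
    proof -
      have "u \<bullet> u = v \<bullet> v"
        using nu by (simp add: norm_eq)
      then show ?thesis
        by (simp add: power2_norm_eq_inner inner_simps algebra_simps)
    qed
    finally have "u \<bullet> (D *v v) \<le> c * (norm v)\<^sup>2"
      by simp
    moreover have "u \<bullet> (D *v v) = norm v * norm (D *v v)"
      using False by (simp add: u_def power2_norm_eq_inner[symmetric] power2_eq_square)
    ultimately show ?thesis
      using \<open>v \<noteq> 0\<close> by (simp add: power2_eq_square mult_ac)
  qed (simp add: \<open>0 \<le> c\<close>)
qed

text \<open>A convex function on a finite-dimensional space is continuous. This makes the
  spectral-norm balls measurable.\<close>

lemma continuous_on_spectral_norm: "continuous_on UNIV (spectral_norm :: real^'n^'m \<Rightarrow> real)"
proof (rule convex_on_continuous)
  show "convex_on UNIV (spectral_norm :: real^'n^'m \<Rightarrow> real)"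
  proof (rule convex_onI)
    fix t :: real and X Y :: "real^'n^'m"
    assume t: "0 < t" "t < 1"
    have "(*v) ((1 - t) *\<^sub>R X + t *\<^sub>R Y) = (\<lambda>v. (1 - t) *\<^sub>R (X *v v) + t *\<^sub>R (Y *v v))"
      by (rule ext) (simp add: matrix_vector_mult_add_rdistrib scaleR_matrix_vector_assoc)
    then have "spectral_norm ((1 - t) *\<^sub>R X + t *\<^sub>R Y)
      = onorm (\<lambda>v. (1 - t) *\<^sub>R (X *v v) + t *\<^sub>R (Y *v v))"
      by (simp add: spectral_norm_def)
    also have "\<dots> \<le> onorm (\<lambda>v. (1 - t) *\<^sub>R (X *v v)) + onorm (\<lambda>v. t *\<^sub>R (Y *v v))"
      by (intro onorm_triangle bounded_linear_const_scaleR matrix_vector_mul_bounded_linear)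
    also have "\<dots> = (1 - t) * spectral_norm X + t * spectral_norm Y"
      using t by (simp add: spectral_norm_def onorm_scaleR[OF matrix_vector_mul_bounded_linear])
    finally show "spectral_norm ((1 - t) *\<^sub>R X + t *\<^sub>R Y) \<le> (1 - t) * spectral_norm X + t * spectral_norm Y" .
  qed simp
qed simp

lemma pos_def_matrix_inv_right:
  fixes S :: "real^'n^'n"
  assumes "pos_def S"
  shows "S ** matrix_inv S = mat 1"
proof -
  have "S *v x = 0 \<longrightarrow> x = 0" for x
    using assms unfolding pos_def_def by (metis inner_zero_right less_irrefl)
  then have "invertible S"
    using matrix_left_invertible_ker[of S] by (simp add: invertible_left_inverse)
  then have "\<exists>T. S ** T = mat 1 \<and> T ** S = mat 1"
    by (simp add: invertible_def)
  then have "S ** matrix_inv S = mat 1 \<and> matrix_inv S ** S = mat 1"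
    unfolding matrix_inv_def by (rule someI_ex)
  then show ?thesis
    by (rule conjunct1)
qed

section \<open>The Riccati map\<close>

text \<open>Pulls the form of \<open>X\<close> back along the transpose of \<open>B\<close>;
  \<open>u v* B\<close> stands for B^T u, likewise for \<open>A\<close> and \<open>C\<close>
  below.\<close>

lemma inner_sandwich:
  "u \<bullet> ((B ** X ** transpose B) *v v) = (u v* B) \<bullet> (X *v (v v* B))"
  for B :: "real^'n^'m"
  by (simp add: matrix_vector_mul_assoc[symmetric] dot_lmul_matrix)

lemma pos_def_innovation:
  assumes "pos_semidef X" "pos_def R"
  shows "pos_def (C ** X ** transpose C + R)"
  using assms
  by (auto simp: pos_def_def pos_semidef_def transpose_eq_iff_inner matrix_vector_mult_add_rdistrib
      inner_add_right inner_sandwich intro: add_nonneg_pos)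

lemma inner_f1:
  fixes C :: "real^'n^'m"
  assumes X: "pos_semidef X" and R: "pos_def R"
  defines "S \<equiv> C ** X ** transpose C + R"
  shows "u \<bullet> (f1 A C Q R X *v v) = (u v* A) \<bullet> (X *v (v v* A)) + u \<bullet> (Q *v v)
     - (C *v (X *v (u v* A))) \<bullet> (matrix_inv S *v (C *v (X *v (v v* A))))"
proof -
  have "x \<bullet> (A *v y) = (x v* A) \<bullet> y" for x y
    by (simp add: dot_lmul_matrix)
  moreover have "x \<bullet> (X *v y) = (X *v x) \<bullet> y" for x y
    using X by (metis pos_semidef_def transpose_eq_iff_inner inner_commute)
  moreover have "x \<bullet> (y v* C) = (C *v x) \<bullet> y" for x y
    by (metis dot_lmul_matrix inner_commute)
  ultimately show ?thesis
    by (simp add: f1_def S_def matrix_vector_mul_assoc[symmetric] matrix_vector_mult_diff_rdistrib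
        matrix_vector_mult_add_rdistrib inner_add_right inner_diff_right)
qed

text \<open>Completing the square in the control \<open>u\<close>; the remainder vanishes at
  \<open>u = S\<^sup>-\<^sup>1 C X A\<^sup>T v\<close>.\<close>
lemma quad_f1:
  fixes C :: "real^'n^'m"
  assumes X: "pos_semidef X" and R: "pos_def R"
  defines "S \<equiv> C ** X ** transpose C + R"
  shows "quad (f1 A C Q R X) v + quad S (u - matrix_inv S *v (C *v (X *v (v v* A))))
    = quad X (v v* A - u v* C) + quad Q v + quad R u"
proof -
  let ?b = "C *v (X *v (v v* A))"
  have S: "pos_def S"
    unfolding S_def by (rule pos_def_innovation[OF X R])
  have sS: "transpose S = S" and sX: "transpose X = X"
    using S X by (auto simp: pos_def_def pos_semidef_def)
  have inv: "S *v (matrix_inv S *v x) = x" for x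
    by (simp add: matrix_vector_mul_assoc pos_def_matrix_inv_right[OF S])
  have "quad S (u - matrix_inv S *v ?b) = quad S u - 2 * (u \<bullet> ?b) + (matrix_inv S *v ?b) \<bullet> ?b"
    by (simp add: quad_diff[OF sS] inv)
  moreover have "quad S u = quad X (u v* C) + quad R u"
    unfolding S_def by (simp add: matrix_vector_mult_add_rdistrib inner_add_right inner_sandwich)
  moreover have "quad X (v v* A - u v* C) = quad X (v v* A) - 2 * (u \<bullet> ?b) + quad X (u v* C)"
  proof -
    have "(v v* A) \<bullet> (X *v (u v* C)) = (u v* C) \<bullet> (X *v (v v* A))"
      using sX by (simp add: transpose_eq_iff_inner)
    also have "\<dots> = u \<bullet> ?b"
      by (rule dot_lmul_matrix)
    finally show ?thesis
      by (simp add: quad_diff[OF sX])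
  qed
  ultimately show ?thesis
    by (simp add: inner_f1[OF X R, where C = C, folded S_def] inner_commute)
qed

text \<open>Every control \<open>u\<close> is a competitor in the minimization, because the
  completed square in \<open>quad_f1\<close> is nonnegative.\<close>

lemma quad_f1_le:
  assumes X: "pos_semidef X" and R: "pos_def R"
  shows "quad (f1 A C Q R X) v \<le> quad X (v v* A - u v* C) + quad Q v + quad R u"
proof -
  have "0 \<le> quad (C ** X ** transpose C + R) x" for x
    using pos_def_imp_pos_semidef[OF pos_def_innovation[OF X R]] unfolding pos_semidef_def by blast
  then show ?thesis
    using quad_f1[OF X R, where A = A and C = C and Q = Q and v = v and u = u] by (smt (verit))
qed

lemma quad_f1_attained:
  assumes X: "pos_semidef X" and R: "pos_def R"
  obtains u where "quad (f1 A C Q R X) v = quad X (v v* A - u v* C) + quad Q v + quad R u"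
  using quad_f1[OF X R, where A = A and C = C and Q = Q and v = v
      and u = "matrix_inv (C ** X ** transpose C + R) *v (C *v (X *v (v v* A)))"] by auto

lemma pos_semidef_f0:
  assumes "pos_semidef X" "pos_semidef Q"
  shows "pos_semidef (f0 A Q X)"
  using assms
  by (auto simp: f0_def pos_semidef_def transpose_eq_iff_inner matrix_vector_mult_add_rdistrib
      inner_add_right inner_sandwich)

text \<open>The form is an attained cost with nonnegative summands; symmetry reduces to that of the
  inverse innovation covariance.\<close>

lemma pos_semidef_f1:
  assumes X: "pos_semidef X" and Q: "pos_semidef Q" and R: "pos_def R"
  shows "pos_semidef (f1 A C Q R X)"
  unfolding pos_semidef_def
proof (intro conjI allI)
  define S where "S = C ** X ** transpose C + R"
  have S: "pos_def S"
    unfolding S_def by (rule pos_def_innovation[OF X R])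
  have "x \<bullet> (matrix_inv S *v y) = y \<bullet> (matrix_inv S *v x)" for x y
  proof -
    have inv: "S *v (matrix_inv S *v z) = z" for z
      by (simp add: matrix_vector_mul_assoc pos_def_matrix_inv_right[OF S])
    have "(matrix_inv S *v x) \<bullet> (S *v (matrix_inv S *v y)) = (matrix_inv S *v y) \<bullet> (S *v (matrix_inv S *v x))"
      using S by (simp add: pos_def_def transpose_eq_iff_inner)
    then show ?thesis
      by (simp add: inv inner_commute)
  qed
  then show "transpose (f1 A C Q R X) = f1 A C Q R X"
    using X Q unfolding transpose_eq_iff_inner inner_f1[OF X R, where C = C, folded S_def]
    by (simp add: pos_semidef_def transpose_eq_iff_inner)
next
  fix v
  obtain u where "quad (f1 A C Q R X) v = quad X (v v* A - u v* C) + quad Q v + quad R u"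
    by (rule quad_f1_attained[OF X R])
  then show "0 \<le> quad (f1 A C Q R X) v"
    using X Q pos_def_imp_pos_semidef[OF R] by (simp add: pos_semidef_def)
qed

section \<open>One step of the invariant law\<close>

lemma space_psd_borel [simp]: "space psd_borel = psd_cone"
  by (simp add: psd_borel_def space_restrict_space)

lemma psd_borel_Int: "U \<in> sets borel \<Longrightarrow> psd_cone \<inter> U \<in> sets psd_borel"
  by (auto simp: psd_borel_def sets_restrict_space)

lemma sets_psd_borel_open: "open U \<Longrightarrow> psd_cone \<inter> U \<in> sets psd_borel"
  by (intro psd_borel_Int) simp

lemma continuous_on_quad: "continuous_on S (\<lambda>X :: real^'n^'n. quad X v)"
  unfolding matrix_vector_mult_def by (intro continuous_intros)

lemma sets_psd_borel_quad:
  "{X \<in> psd_cone. c < quad X (v :: real^'n)} \<in> sets psd_borel"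
proof -
  have "{X \<in> psd_cone. c < quad X v} = psd_cone \<inter> {X. c < quad X v}"
    by auto
  then show ?thesis
    using sets_psd_borel_open[OF open_Collect_less[OF continuous_on_const continuous_on_quad, of c v]]
    by simp
qed

text \<open>By invariance the mass of \<open>B\<close> is the probability of lying in
  \<open>B\<close> after one more step. A measurement update gets there only from \<open>B'\<close>,
  and a measurement is lost with probability \<open>1 - g\<close>.\<close>

lemma invariant_distribution_step:
  assumes inv: "invariant_distribution A C Q R g \<nu>" and g: "0 < g" "g < 1"
    and Q: "pos_def Q" and R: "pos_def R"
    and B: "B \<in> sets psd_borel" and B': "B' \<in> sets psd_borel"
    and pre: "\<And>X. X \<in> psd_cone \<Longrightarrow> f1 A C Q R X \<in> B \<Longrightarrow> X \<in> B'"
  shows "measure \<nu> B \<le> measure \<nu> B' + (1 - g)"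
proof -
  interpret prob_space \<nu>
    using inv by (simp add: invariant_distribution_def)
  have sets: "sets \<nu> = sets psd_borel"
    using inv by (simp add: invariant_distribution_def)
  have space: "space \<nu> = psd_cone"
    using sets_eq_imp_space_eq[OF sets] by simp
  have "emeasure (riccati_kernel A C Q R g X) B \<le> indicator B' X + ennreal (1 - g)"
    if X: "X \<in> psd_cone" for X
  proof -
    let ?f = "\<lambda>b. if b then f1 A C Q R X else f0 A Q X"
    have "pos_semidef X" "pos_semidef Q"
      using X Q by (auto simp: psd_cone_def pos_def_imp_pos_semidef)
    \<comment> \<open>The Bernoulli space is discrete, so measurability of the one-step map only
      asks that both branches stay in the cone.\<close>
    then have "?f b \<in> psd_cone" for b
      by (simp add: psd_cone_def pos_semidef_f0 pos_semidef_f1 R)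
    then have "?f \<in> measurable (measure_pmf (bernoulli_pmf g)) psd_borel"
      by simp
    then have "emeasure (riccati_kernel A C Q R g X) B
      = emeasure (measure_pmf (bernoulli_pmf g)) (?f -` B)"
      using B by (simp add: riccati_kernel_def emeasure_distr)
    also have "\<dots> \<le> indicator B' X + ennreal (1 - g)"
    proof (cases "X \<in> B'")
      case True
      then show ?thesis
        using measure_pmf.emeasure_le_1[of "bernoulli_pmf g" "?f -` B"]
        by (simp add: add_increasing2)
    next
      case False
      \<comment> \<open>From outside \<open>B'\<close> only a lost measurement can lead into
        \<open>B\<close>.\<close>
      then have "?f -` B \<subseteq> {False}"
        using pre[OF X] by (auto split: if_splits)
      then have "emeasure (measure_pmf (bernoulli_pmf g)) (?f -` B)
        \<le> emeasure (measure_pmf (bernoulli_pmf g)) {False}"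
        by (intro emeasure_mono) auto
      then show ?thesis
        using g False by (simp add: emeasure_pmf_single)
    qed
    finally show ?thesis .
  qed
  then have "(\<integral>\<^sup>+X. emeasure (riccati_kernel A C Q R g X) B \<partial>\<nu>)
    \<le> (\<integral>\<^sup>+X. indicator B' X + ennreal (1 - g) \<partial>\<nu>)"
    by (intro nn_integral_mono) (simp add: space)
  also have "\<dots> = emeasure \<nu> B' + ennreal (1 - g)"
    using B' sets by (subst nn_integral_add) (auto simp: emeasure_space_1)
  finally have "emeasure \<nu> B \<le> emeasure \<nu> B' + ennreal (1 - g)"
    using inv B by (simp add: invariant_distribution_def)
  then show ?thesis
    using g by (simp add: emeasure_eq_measure flip: ennreal_plus)
qed

section \<open>Observability\<close>

text \<open>The vectors that a control sequence of length \<open>n\<close> can cancel in the adjoint system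
  \<open>w \<mapsto> A\<^sup>T w - C\<^sup>T u\<close>.\<close>
primrec reachable :: "real^'n^'n \<Rightarrow> real^'n^'m \<Rightarrow> nat \<Rightarrow> (real^'n) set" where
  "reachable A C 0 = {0}"
| "reachable A C (Suc n) = {x + ((\<lambda>w. w v* A) ^^ n) (u v* C) | x u. x \<in> reachable A C n}"

lemma funpow_Suc_vector_matrix:
  "((\<lambda>w. w v* A) ^^ Suc n) v = ((\<lambda>w. w v* A) ^^ n) (v v* A)"
  unfolding funpow_Suc_right by simp

lemma linear_funpow_vector_matrix: "linear ((\<lambda>w. w v* A) ^^ n)" for A :: "real^'n^'n"
proof (induction n)
  case 0
  then show ?case by (simp add: linear_id[unfolded id_def] id_def)
next
  case (Suc n)
  have "linear (\<lambda>w. w v* A)"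
    using matrix_vector_mul_linear[of "transpose A"] by simp
  then show ?case
    using linear_compose[OF Suc] by (simp add: comp_def)
qed

lemma subspace_reachable: "subspace (reachable A C n)"
proof (induction n)
  case (Suc n)
  let ?T = "\<lambda>u. ((\<lambda>w. w v* A) ^^ n) (u v* C)"
  have "linear (\<lambda>u. u v* C)"
    using matrix_vector_mul_linear[of "transpose C"] by simp
  then have "linear ?T"
    using linear_compose[OF _ linear_funpow_vector_matrix] by (simp add: comp_def)
  then have "subspace (range ?T)"
    by (rule linear_subspace_image[OF _ subspace_UNIV])
  then have "subspace {x + y | x y. x \<in> reachable A C n \<and> y \<in> range ?T}"
    by (rule subspace_sums[OF Suc])
  also have "{x + y | x y. x \<in> reachable A C n \<and> y \<in> range ?T} = reachable A C (Suc n)"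
    by auto
  finally show ?case .
qed (simp add: subspace_single_0)

lemma reachable_control:
  "k < n \<Longrightarrow> ((\<lambda>w. w v* A) ^^ k) (u v* C) \<in> reachable A C n"
proof (induction n)
  case (Suc n)
  show ?case
  proof (cases "k = n")
    case True
    have "0 \<in> reachable A C n"
      by (rule subspace_0[OF subspace_reachable])
    then show ?thesis
      using True by force
  next
    case False
    then have "((\<lambda>w. w v* A) ^^ k) (u v* C) \<in> reachable A C n"
      using Suc by simp
    moreover have "((\<lambda>w. w v* A) ^^ n) (0 v* C) = 0"
      by (simp add: linear_0[OF linear_funpow_vector_matrix])
    ultimately show ?thesis
      unfolding reachable.simps by (metis (mono_tags, lifting) add.right_neutral mem_Collect_eq)
  qed
qed simp

lemma vector_mat_pow: "w v* mat_pow A k = ((\<lambda>w. w v* A) ^^ k) w"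
proof (induction k arbitrary: w)
  case (Suc k)
  have "w v* mat_pow A (Suc k) = (w v* A) v* mat_pow A k"
    by (simp add: mat_pow_def vector_matrix_mul_assoc)
  then show ?case
    by (simp only: Suc funpow_Suc_vector_matrix)
qed (simp add: mat_pow_def)

lemma row_eq_axis: "row i X = axis i 1 v* X" for X :: "real^'n^'m"
  by (simp add: vec_eq_iff row_def vector_matrix_mult_def axis_def if_distrib if_distribR cong: if_cong)

text \<open>The rows of C A^k are the vectors (A^T)^k C^T e_i. For k < N each lies in the subspace
  of reachable vectors, and the rank condition says that together they span the whole space.\<close>

lemma observable_reachable:
  fixes A :: "real^'n^'n"
  assumes "observable C A"
  shows "reachable A C CARD('n) = UNIV"
proof -
  have "(\<Union>k<CARD('n). rows (C ** mat_pow A k)) \<subseteq> reachable A C CARD('n)"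
    by (auto simp: rows_def row_eq_axis vector_matrix_mul_assoc[symmetric] vector_mat_pow
        intro: reachable_control)
  then have "span (\<Union>k<CARD('n). rows (C ** mat_pow A k)) \<subseteq> reachable A C CARD('n)"
    by (rule span_minimal[OF _ subspace_reachable])
  moreover have "span (\<Union>k<CARD('n). rows (C ** mat_pow A k)) = (UNIV :: (real^'n) set)"
    using assms by (simp add: observable_def flip: dim_eq_full)
  ultimately show ?thesis
    by auto
qed

text \<open>A control that steers \<open>v\<close> to \<open>0\<close> in \<open>n\<close> steps makes the cost of \<open>v\<close> after \<open>n\<close> measurement
  updates independent of the initial covariance.\<close>
lemma invariant_distribution_quad_tail:
  assumes Q: "pos_def Q" and R: "pos_def R"
    and "((\<lambda>w. w v* A) ^^ n) v \<in> reachable A C n"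
  shows "\<exists>c. \<forall>g \<nu>. 0 < g \<longrightarrow> g < 1 \<longrightarrow> invariant_distribution A C Q R g \<nu> \<longrightarrow>
    measure \<nu> {X \<in> psd_cone. c < quad X v} \<le> real n * (1 - g)"
  using assms(3)
proof (induction n arbitrary: v)
  case 0
  \<comment> \<open>With no steps left the hypothesis forces \<open>v = 0\<close>, whose cost is 0
    for every \<open>X\<close>.\<close>
  then show ?case by (intro exI[of _ 0]) simp
next
  case (Suc n)
  let ?M = "(\<lambda>w. w v* A) ^^ n"
  \<comment> \<open>The newest summand is the control applied first, since it is still carried
    through the other \<open>n\<close> steps. It leaves the vector \<open>w\<close> to be steered to
    0 in \<open>n\<close> steps.\<close>
  obtain x u where x: "x \<in> reachable A C n" and eq: "?M (v v* A) = x + ?M (u v* C)"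
    using Suc.prems unfolding funpow_Suc_vector_matrix by auto
  define w where "w = v v* A - u v* C"
  have "?M w = x"
    using eq by (simp add: w_def linear_diff[OF linear_funpow_vector_matrix])
  then obtain c where c: "\<And>g \<nu>. 0 < g \<Longrightarrow> g < 1 \<Longrightarrow> invariant_distribution A C Q R g \<nu> \<Longrightarrow>
      measure \<nu> {X \<in> psd_cone. c < quad X w} \<le> real n * (1 - g)"
    using Suc.IH[of w] x by blast
  \<comment> \<open>The threshold grows by the stage cost of \<open>u\<close> and stays independent
    of \<open>g\<close> and \<nu>.\<close>
  have "measure \<nu> {X \<in> psd_cone. c + quad Q v + quad R u < quad X v} \<le> real (Suc n) * (1 - g)"
    if g: "0 < g" "g < 1" and inv: "invariant_distribution A C Q R g \<nu>" for g \<nu>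
  proof -
    have "measure \<nu> {X \<in> psd_cone. c + quad Q v + quad R u < quad X v}
      \<le> measure \<nu> {X \<in> psd_cone. c < quad X w} + (1 - g)"
    proof (rule invariant_distribution_step[OF inv g Q R sets_psd_borel_quad sets_psd_borel_quad])
      fix X
      assume "X \<in> psd_cone"
        and "f1 A C Q R X \<in> {X \<in> psd_cone. c + quad Q v + quad R u < quad X v}"
      then show "X \<in> {X \<in> psd_cone. c < quad X w}"
        using quad_f1_le[OF _ R, where X = X and A = A and C = C and Q = Q and v = v and u = u] by (auto simp: psd_cone_def w_def)
    qed
    then show ?thesis
      using c[OF g inv] by (simp add: algebra_simps)
  qed
  then show ?case
    by blast
qed

section \<open>Contraction in the order of the fixed point\<close>

text \<open>The order interval \<open>(1 - e) P \<le> X \<le> (1 + e) P\<close>.\<close>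
definition order_ball :: "real \<Rightarrow> real^'n^'n \<Rightarrow> (real^'n^'n) set" where
  "order_ball e P = {X \<in> psd_cone. \<forall>v. \<bar>quad X v - quad P v\<bar> \<le> e * quad P v}"

text \<open>The intersection over \<open>v\<close> is uncountable; it is closedness of each
  condition that gives measurability.\<close>

lemma sets_psd_borel_order_ball: "psd_cone - order_ball e P \<in> sets psd_borel"
proof -
  have "closed (\<Inter>v. {X. \<bar>quad X v - quad P v\<bar> \<le> e * quad P v})"
    by (intro closed_INT ballI closed_Collect_le continuous_intros continuous_on_quad)
  then have "psd_cone \<inter> - (\<Inter>v. {X. \<bar>quad X v - quad P v\<bar> \<le> e * quad P v}) \<in> sets psd_borel"
    by (intro sets_psd_borel_open open_Compl)
  also have "psd_cone \<inter> - (\<Inter>v. {X. \<bar>quad X v - quad P v\<bar> \<le> e * quad P v})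
    = psd_cone - order_ball e P"
    by (auto simp: order_ball_def)
  finally show ?thesis .
qed

text \<open>Each bound uses the control that is optimal for one of the two matrices as a
  competitor for the other one.\<close>
lemma order_ball_f1:
  assumes Q: "pos_def Q" and R: "pos_def R" and P: "P \<in> psd_cone" and fixp: "f1 A C Q R P = P"
    and d: "\<And>v. d * quad P v \<le> quad Q v" "d \<le> 1" and e: "0 \<le> e"
    and X: "X \<in> order_ball e P"
  shows "f1 A C Q R X \<in> order_ball ((1 - d) * e) P"
proof -
  have pX: "pos_semidef X" and pP: "pos_semidef P"
    using X P by (auto simp: order_ball_def psd_cone_def)
  have R0: "0 \<le> quad R u" for u
    using pos_def_imp_pos_semidef[OF R] by (simp add: pos_semidef_def)
  have X_le: "quad X v \<le> (1 + e) * quad P v" and X_ge: "(1 - e) * quad P v \<le> quad X v" for v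
    using X by (auto simp: order_ball_def abs_le_iff algebra_simps)
  have "\<bar>quad (f1 A C Q R X) v - quad P v\<bar> \<le> (1 - d) * e * quad P v" for v
  proof -
    \<comment> \<open>The stage cost contains \<open>Q\<close>, hence at least the fraction
      \<open>d\<close> of \<open>P\<close>. This is the source of the contraction.\<close>
    have cost: "e * (d * quad P v) \<le> e * (quad Q v + quad R u)" for u
      using d(1)[of v] R0[of u] e by (intro mult_left_mono) auto
    obtain u where u: "quad (f1 A C Q R X) v = quad X (v v* A - u v* C) + quad Q v + quad R u"
      by (rule quad_f1_attained[OF pX R])
    have lower: "quad P v - (1 - d) * e * quad P v \<le> quad (f1 A C Q R X) v"
    proof (cases "e \<le> 1")
      case True
      then have "(1 - e) * quad P v \<le> (1 - e) * (quad P (v v* A - u v* C) + quad Q v + quad R u)"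
        using quad_f1_le[OF pP R, where A = A and C = C and Q = Q and v = v and u = u] by (intro mult_left_mono) (auto simp: fixp)
      moreover have "(1 - e) * quad P (v v* A - u v* C) \<le> quad X (v v* A - u v* C)"
        by (rule X_ge)
      ultimately show ?thesis
        using u cost[of u] by (simp add: algebra_simps)
    next
      case False
      \<comment> \<open>For \<open>e > 1\<close> the factor \<open>1 - e\<close> is negative and
        would reverse the comparison; the lower bound by \<open>Q\<close> alone suffices
        here.\<close>
      have "0 \<le> (1 - d) * (e - 1) * quad P v"
        using False d(2) pP by (simp add: pos_semidef_def)
      then have "quad P v - (1 - d) * e * quad P v \<le> d * quad P v"
        by (simp add: algebra_simps)
      also have "\<dots> \<le> quad Q v"
        by (rule d)
      also have "\<dots> \<le> quad (f1 A C Q R X) v"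
        using u R0[of u] pX by (simp add: pos_semidef_def)
      finally show ?thesis .
    qed
    obtain u' where u': "quad P v = quad P (v v* A - u' v* C) + quad Q v + quad R u'"
      using quad_f1_attained[OF pP R, where A = A and C = C and Q = Q and v = v] fixp by metis
    have "quad (f1 A C Q R X) v \<le> quad X (v v* A - u' v* C) + quad Q v + quad R u'"
      by (rule quad_f1_le[OF pX R])
    also have "\<dots> \<le> (1 + e) * quad P (v v* A - u' v* C) + quad Q v + quad R u'"
      using X_le by simp
    \<comment> \<open>Only the remaining cost carries the factor \<open>1 + e\<close>. Extending it
      to the whole cost overcounts by \<open>e\<close> times the stage cost, which is the
      gain.\<close>
    also have "\<dots> = (1 + e) * quad P v - e * (quad Q v + quad R u')"
      unfolding u' by (simp add: algebra_simps)
    also have "\<dots> \<le> quad P v + (1 - d) * e * quad P v"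
      using cost[of u'] by (simp add: algebra_simps)
    finally show ?thesis
      using lower by linarith
  qed
  then show ?thesis
    using pos_semidef_f1[OF pX pos_def_imp_pos_semidef[OF Q] R]
    by (simp add: order_ball_def psd_cone_def)
qed

lemma quad_fixed_point_ge:
  assumes "pos_semidef P" "pos_def R" "f1 A C Q R P = P"
  shows "quad Q v \<le> quad P v"
proof -
  obtain u where "quad P v = quad P (v v* A - u v* C) + quad Q v + quad R u"
    using quad_f1_attained[OF assms(1,2), where A = A and C = C and Q = Q and v = v] assms(3) by metis
  then show ?thesis
    using assms(1) pos_def_imp_pos_semidef[OF assms(2)] by (simp add: pos_semidef_def)
qed

section \<open>Tail bounds uniform in the success probability\<close>

lemma quad_le_axis_bounds:
  fixes X :: "real^'n^'n"
  assumes X: "pos_semidef X" and c: "\<And>i. quad X (axis i 1) \<le> c i"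
  shows "quad X v \<le> 2 ^ CARD('n) * (\<Sum>i\<in>UNIV. c i) * (norm v)\<^sup>2"
proof -
  have nn: "0 \<le> quad X w" for w
    using X by (simp add: pos_semidef_def)
  have "quad X v = quad X (\<Sum>i\<in>UNIV. (v $ i) *\<^sub>R axis i 1)"
    using basis_expansion[of v] by (simp add: scalar_mult_eq_scaleR)
  also have "\<dots> \<le> 2 ^ CARD('n) * (\<Sum>i\<in>UNIV. quad X ((v $ i) *\<^sub>R axis i 1))"
    by (rule quad_sum_le[OF X]) simp
  also have "\<dots> \<le> 2 ^ CARD('n) * (\<Sum>i\<in>UNIV. (norm v)\<^sup>2 * c i)"
  proof (intro mult_left_mono sum_mono)
    fix i
    have "(v $ i)\<^sup>2 \<le> (norm v)\<^sup>2"
      using component_le_norm_cart[of v i] by (simp add: abs_le_square_iff[symmetric])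
    then show "quad X ((v $ i) *\<^sub>R axis i 1) \<le> (norm v)\<^sup>2 * c i"
      unfolding quad_scaleR by (intro mult_mono c nn) auto
  qed simp
  finally show ?thesis
    by (simp add: sum_distrib_left sum_distrib_right mult_ac)
qed

text \<open>Observability bounds the form along each axis outside a set of mass at most N (1 - g),
  and a union bound covers all axes. The resulting bound is relative to \<open>P\<close> because
  \<open>P\<close> dominates the coercive form of \<open>Q\<close>.\<close>

lemma order_ball_initial_tail:
  fixes A Q P :: "real^'n^'n"
  assumes obs: "observable C A" and Q: "pos_def Q" and R: "pos_def R"
    and P: "P \<in> psd_cone" and fixp: "f1 A C Q R P = P"
  obtains e K where "0 \<le> e" "0 \<le> K"
    "\<And>g \<nu>. 0 < g \<Longrightarrow> g < 1 \<Longrightarrow> invariant_distribution A C Q R g \<nu> \<Longrightarrow>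
      measure \<nu> (psd_cone - order_ball e P) \<le> K * (1 - g)"
proof -
  let ?N = "CARD('n)"
  have pP: "pos_semidef P"
    using P by (simp add: psd_cone_def)
  have "\<exists>c. \<forall>g \<nu>. 0 < g \<longrightarrow> g < 1 \<longrightarrow> invariant_distribution A C Q R g \<nu> \<longrightarrow>
      measure \<nu> {X \<in> psd_cone. c < quad X (axis i 1)} \<le> real ?N * (1 - g)" for i :: 'n
    by (rule invariant_distribution_quad_tail[OF Q R]) (simp add: observable_reachable[OF obs])
  then have "\<exists>c. \<forall>i. \<forall>g \<nu>. 0 < g \<longrightarrow> g < 1 \<longrightarrow> invariant_distribution A C Q R g \<nu> \<longrightarrow>
      measure \<nu> {X \<in> psd_cone. c i < quad X (axis i 1)} \<le> real ?N * (1 - g)"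
    by (intro choice allI)
  then obtain c where c: "\<And>i g \<nu>. 0 < g \<Longrightarrow> g < 1 \<Longrightarrow> invariant_distribution A C Q R g \<nu> \<Longrightarrow>
      measure \<nu> {X \<in> psd_cone. c i < quad X (axis i 1)} \<le> real ?N * (1 - g)"
    by blast
  obtain a where a: "0 < a" "\<And>v. a * (norm v)\<^sup>2 \<le> quad Q v"
    using pos_def_coercive[OF Q] by metis
  \<comment> \<open>Nothing is known about the signs of the \<open>c i\<close>; the absolute values
    make \<open>b\<close> nonnegative.\<close>
  define b where "b = 2 ^ ?N * (\<Sum>i\<in>UNIV. \<bar>c i\<bar>)"
  have "0 \<le> b"
    by (simp add: b_def sum_nonneg)
  have sub: "psd_cone - order_ball (1 + b / a) P \<subseteq> (\<Union>i. {X \<in> psd_cone. c i < quad X (axis i 1)})"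
  proof
    fix X
    assume X: "X \<in> psd_cone - order_ball (1 + b / a) P"
    then have pX: "pos_semidef X"
      by (simp add: psd_cone_def)
    show "X \<in> (\<Union>i. {X \<in> psd_cone. c i < quad X (axis i 1)})"
    proof (rule ccontr)
      assume "X \<notin> (\<Union>i. {X \<in> psd_cone. c i < quad X (axis i 1)})"
      then have "\<not> c i < quad X (axis i 1)" for i
        using X by blast
      then have axis: "quad X (axis i 1) \<le> \<bar>c i\<bar>" for i
        by (smt (verit))
      \<comment> \<open>The term \<open>b / a\<close> covers the upper side, the summand 1 the lower
        side, where only \<open>0 \<le> quad X v\<close> is available.\<close>
      have "\<bar>quad X v - quad P v\<bar> \<le> (1 + b / a) * quad P v" for v
      proof -
        have "a * (norm v)\<^sup>2 \<le> quad P v"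
          using a(2) quad_fixed_point_ge[OF pP R fixp] by (rule order_trans)
        have "quad X v \<le> b * (norm v)\<^sup>2"
          unfolding b_def by (rule quad_le_axis_bounds[OF pX axis])
        also have "\<dots> = b / a * (a * (norm v)\<^sup>2)"
          using a(1) by simp
        also have "\<dots> \<le> b / a * quad P v"
          using \<open>a * (norm v)\<^sup>2 \<le> quad P v\<close> \<open>0 \<le> b\<close> a(1) by (intro mult_left_mono) auto
        finally have "quad X v \<le> b / a * quad P v" .
        moreover have "0 \<le> quad X v" "0 \<le> quad P v"
          using pX pP by (auto simp: pos_semidef_def)
        ultimately show ?thesis
          by (simp add: distrib_right abs_le_iff)
      qed
      then show False
        using X by (simp add: order_ball_def)
    qed
  qed
  show thesis
  \<comment> \<open>One factor N counts the axes, the other the steps spent on each axis.\<close>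
  proof (rule that[of "1 + b / a" "real ?N * real ?N"])
    show "0 \<le> 1 + b / a" "0 \<le> real ?N * real ?N"
      using \<open>0 \<le> b\<close> a(1) by auto
    fix g \<nu>
    assume g: "0 < g" "g < 1" and inv: "invariant_distribution A C Q R g \<nu>"
    then interpret prob_space \<nu>
      by (simp add: invariant_distribution_def)
    have sets: "sets \<nu> = sets psd_borel"
      using inv by (simp add: invariant_distribution_def)
    have "measure \<nu> (psd_cone - order_ball (1 + b / a) P)
      \<le> measure \<nu> (\<Union>i. {X \<in> psd_cone. c i < quad X (axis i 1)})"
      using sub by (rule finite_measure_mono) (auto simp: sets sets_psd_borel_quad)
    also have "\<dots> \<le> (\<Sum>i\<in>UNIV. measure \<nu> {X \<in> psd_cone. c i < quad X (axis i 1)})"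
      by (rule finite_measure_subadditive_finite) (auto simp: sets sets_psd_borel_quad)
    also have "\<dots> \<le> (\<Sum>i\<in>(UNIV :: 'n set). real ?N * (1 - g))"
      by (intro sum_mono c[OF g inv])
    finally show "measure \<nu> (psd_cone - order_ball (1 + b / a) P) \<le> real ?N * real ?N * (1 - g)"
      by (simp add: mult_ac)
  qed
qed

text \<open>By the contraction, being outside the smaller ball after an update means having been
  outside the larger one before, so each of the \<open>j\<close> steps costs at most
  \<open>1 - g\<close>.\<close>

lemma order_ball_iterated_tail:
  assumes Q: "pos_def Q" and R: "pos_def R" and P: "P \<in> psd_cone" and fixp: "f1 A C Q R P = P"
    and d: "\<And>v. d * quad P v \<le> quad Q v" "d \<le> 1" and e: "0 \<le> e"
    and g: "0 < g" "g < 1" and inv: "invariant_distribution A C Q R g \<nu>"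
  shows "measure \<nu> (psd_cone - order_ball ((1 - d) ^ j * e) P)
    \<le> measure \<nu> (psd_cone - order_ball e P) + real j * (1 - g)"
proof (induction j)
  case (Suc j)
  have "measure \<nu> (psd_cone - order_ball ((1 - d) ^ Suc j * e) P)
    \<le> measure \<nu> (psd_cone - order_ball ((1 - d) ^ j * e) P) + (1 - g)"
  proof (rule invariant_distribution_step[OF inv g Q R sets_psd_borel_order_ball sets_psd_borel_order_ball])
    fix X
    assume "X \<in> psd_cone"
      and "f1 A C Q R X \<in> psd_cone - order_ball ((1 - d) ^ Suc j * e) P"
    then show "X \<in> psd_cone - order_ball ((1 - d) ^ j * e) P"
      using order_ball_f1[OF Q R P fixp d, of "(1 - d) ^ j * e" X] d(2) e by (auto simp: mult.assoc)
  qed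
  then show ?case
    using Suc by (simp add: algebra_simps)
qed simp

lemma spectral_norm_order_ball:
  assumes "P \<in> psd_cone" "0 \<le> e" "X \<in> order_ball e P"
  shows "spectral_norm (X - P) \<le> e * spectral_norm P"
proof (rule spectral_norm_le_quad)
  show "transpose (X - P) = X - P"
    using assms by (auto simp: order_ball_def psd_cone_def pos_semidef_def transpose_eq_iff_inner
        matrix_vector_mult_diff_rdistrib inner_diff_right)
  show "0 \<le> e * spectral_norm P"
    using assms(2) spectral_norm_nonneg[of P] by simp
  show "\<bar>quad (X - P) v\<bar> \<le> e * spectral_norm P * (norm v)\<^sup>2" for v
  proof -
    have "\<bar>quad (X - P) v\<bar> \<le> e * quad P v"
      using assms(3) by (simp add: order_ball_def matrix_vector_mult_diff_rdistrib inner_diff_right)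
    also have "\<dots> \<le> e * (spectral_norm P * (norm v)\<^sup>2)"
      by (intro mult_left_mono quad_le_norm assms)
    finally show ?thesis
      by (simp add: mult.assoc)
  qed
qed

lemma invariant_distribution_ball_compl_tail:
  fixes A Q P :: "real^'n^'n"
  assumes obs: "observable C A" and Q: "pos_def Q" and R: "pos_def R"
    and P: "P \<in> psd_cone" and fixp: "f1 A C Q R P = P" and "0 < \<epsilon>"
  obtains K where "0 < K"
    "\<And>g \<nu>. 0 < g \<Longrightarrow> g < 1 \<Longrightarrow> invariant_distribution A C Q R g \<nu> \<Longrightarrow>
      measure \<nu> (ball_compl \<epsilon> P) \<le> K * (1 - g)"
proof -
  obtain e K where e: "0 \<le> e" and K: "0 \<le> K"
    "\<And>g \<nu>. 0 < g \<Longrightarrow> g < 1 \<Longrightarrow> invariant_distribution A C Q R g \<nu> \<Longrightarrow>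
      measure \<nu> (psd_cone - order_ball e P) \<le> K * (1 - g)"
    using order_ball_initial_tail[OF obs Q R P fixp] by blast
  obtain a where a: "0 < a" "\<And>v. a * (norm v)\<^sup>2 \<le> quad Q v"
    using pos_def_coercive[OF Q] by metis
  let ?b = "spectral_norm P"
  \<comment> \<open>\<open>Q\<close> is at least \<open>a\<close> and \<open>P\<close> at most
    \<open>?b\<close> times the squared norm; the extra \<open>a\<close> in the denominator puts
    \<open>d\<close> into (0, 1] at once.\<close>
  define d where "d = a / (a + ?b)"
  have b: "0 \<le> ?b"
    by (rule spectral_norm_nonneg)
  have d01: "0 < d" "d \<le> 1"
    using a(1) b by (auto simp: d_def)
  have d: "d * quad P v \<le> quad Q v" for v
  proof -
    have "d * quad P v \<le> d * (?b * (norm v)\<^sup>2)"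
      using d01 by (intro mult_left_mono quad_le_norm) auto
    also have "\<dots> = d * ?b * (norm v)\<^sup>2"
      by simp
    also have "\<dots> \<le> a * (norm v)\<^sup>2"
      using a(1) b by (intro mult_right_mono) (auto simp: d_def divide_simps algebra_simps)
    also have "\<dots> \<le> quad Q v"
      by (rule a)
    finally show ?thesis .
  qed
  \<comment> \<open>The number \<open>j\<close> of contractions depends on \<epsilon> and the system
    matrices, but not on \<open>g\<close> or \<nu>.\<close>
  have "(\<lambda>j. (1 - d) ^ j * e * ?b) \<longlonglongrightarrow> 0 * e * ?b"
    using d01 by (intro tendsto_intros LIMSEQ_realpow_zero) auto
  then have "eventually (\<lambda>j. (1 - d) ^ j * e * ?b < \<epsilon>) sequentially"
    using \<open>0 < \<epsilon>\<close> by (simp add: order_tendstoD(2))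
  then obtain j where j: "(1 - d) ^ j * e * ?b < \<epsilon>"
    by (auto simp: eventually_sequentially)
  have sub: "ball_compl \<epsilon> P \<subseteq> psd_cone - order_ball ((1 - d) ^ j * e) P"
  proof
    fix X
    assume X: "X \<in> ball_compl \<epsilon> P"
    have "0 \<le> (1 - d) ^ j * e"
      using d01 e by simp
    then show "X \<in> psd_cone - order_ball ((1 - d) ^ j * e) P"
      using X j spectral_norm_order_ball[OF P, of "(1 - d) ^ j * e" X] by (auto simp: ball_compl_def)
  qed
  show thesis
  \<comment> \<open>The summand 1 makes the constant positive, as its logarithm is taken
    later.\<close>
  proof (rule that[of "K + real j + 1"])
    fix g \<nu>
    assume g: "0 < g" "g < 1" and inv: "invariant_distribution A C Q R g \<nu>"
    then interpret prob_space \<nu>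
      by (simp add: invariant_distribution_def)
    have sets: "sets \<nu> = sets psd_borel"
      using inv by (simp add: invariant_distribution_def)
    have "measure \<nu> (ball_compl \<epsilon> P) \<le> measure \<nu> (psd_cone - order_ball ((1 - d) ^ j * e) P)"
      using sub by (rule finite_measure_mono) (simp add: sets sets_psd_borel_order_ball)
    also have "\<dots> \<le> measure \<nu> (psd_cone - order_ball e P) + real j * (1 - g)"
      by (rule order_ball_iterated_tail[OF Q R P fixp d d01(2) e g inv])
    also have "\<dots> \<le> (K + real j + 1) * (1 - g)"
      using K(2)[OF g inv] g by (simp add: algebra_simps)
    finally show "measure \<nu> (ball_compl \<epsilon> P) \<le> (K + real j + 1) * (1 - g)" .
  qed (use K(1) in simp)
qed

section \<open>Prohorov distance and logarithmic rate\<close>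

lemma sets_psd_borel_ball_compl: "ball_compl \<epsilon> P \<in> sets psd_borel"
proof -
  have "continuous_on UNIV (\<lambda>X. spectral_norm (X - P))"
    by (rule continuous_on_compose2[OF continuous_on_spectral_norm]) (auto intro!: continuous_intros)
  then have "closed {X. \<epsilon> \<le> spectral_norm (X - P)}"
    by (intro closed_Collect_le continuous_on_const)
  then have "psd_cone \<inter> {X. \<epsilon> \<le> spectral_norm (X - P)} \<in> sets psd_borel"
    by (intro psd_borel_Int) simp
  then show ?thesis
    by (simp add: ball_compl_def Int_def)
qed

text \<open>The infimum is below \<epsilon> exactly if some point of \<open>F\<close> is that close,
  so the neighbourhood is a union of open balls cut with the cone.\<close>

lemma sets_psd_borel_nbhd: "psd_nbhd F \<epsilon> \<in> sets psd_borel"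
proof -
  have "continuous_on UNIV (\<lambda>Y. spectral_norm (Y - X))" for X :: "real^'a^'a"
    by (rule continuous_on_compose2[OF continuous_on_spectral_norm]) (auto intro!: continuous_intros)
  then have "open (\<Union>X\<in>F. {Y. spectral_norm (Y - X) < \<epsilon>})"
    by (intro open_UN ballI open_Collect_less continuous_on_const)
  then have "psd_cone \<inter> (\<Union>X\<in>F. {Y. spectral_norm (Y - X) < \<epsilon>}) \<in> sets psd_borel"
    by (rule sets_psd_borel_open)
  also have "psd_cone \<inter> (\<Union>X\<in>F. {Y. spectral_norm (Y - X) < \<epsilon>}) = psd_nbhd F \<epsilon>"
    by (auto simp: psd_nbhd_def INF_less_iff)
  finally show ?thesis .
qed

lemma spectral_norm_minus_commute: "spectral_norm (X - Y) = spectral_norm (Y - X)"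
proof -
  have "onorm (\<lambda>v. - ((Y - X) *v v)) = onorm ((*v) (Y - X))"
    by (rule onorm_neg)
  moreover have "(*v) (X - Y) = (\<lambda>v. - ((Y - X) *v v))"
    by (rule ext) (simp add: matrix_vector_mult_diff_rdistrib)
  ultimately show ?thesis
    by (simp add: spectral_norm_def)
qed

text \<open>Either \<open>P\<close> is \<epsilon>-close to \<open>F\<close> and the Dirac mass of
  the neighbourhood is 1, or \<open>F\<close> lies in the complement of the ball, whose mass is at
  most \<epsilon>. So \<epsilon> is admissible in the infimum.\<close>

lemma prohorov_dist_dirac_bounds:
  assumes \<nu>: "prob_space \<nu>" "sets \<nu> = sets psd_borel" and P: "P \<in> psd_cone"
    and "0 < \<epsilon>" and tail: "measure \<nu> (ball_compl \<epsilon> P) \<le> \<epsilon>"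
  shows "0 \<le> prohorov_dist \<nu> (return psd_borel P)" "prohorov_dist \<nu> (return psd_borel P) \<le> \<epsilon>"
proof -
  interpret prob_space \<nu> by fact
  let ?S = "{\<delta>. 0 < \<delta> \<and> (\<forall>F. closedin (top_of_set psd_cone) F \<longrightarrow>
    measure \<nu> F \<le> measure (return psd_borel P) (psd_nbhd F \<delta>) + \<delta>)}"
  have "measure \<nu> F \<le> measure (return psd_borel P) (psd_nbhd F \<epsilon>) + \<epsilon>"
    if F: "closedin (top_of_set psd_cone) F" for F
  proof (cases "P \<in> psd_nbhd F \<epsilon>")
    case True
    then have "measure (return psd_borel P) (psd_nbhd F \<epsilon>) = 1"
      by (simp add: measure_return sets_psd_borel_nbhd)
    then show ?thesis
      using prob_le_1[of F] \<open>0 < \<epsilon>\<close> by linarith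
  next
    case False
    have "F \<subseteq> psd_cone"
      using F by (rule closedin_imp_subset)
    moreover have "\<epsilon> \<le> spectral_norm (X - P)" if "X \<in> F" for X
      using False P that by (auto simp: psd_nbhd_def INF_less_iff not_less spectral_norm_minus_commute[of X])
    ultimately have "F \<subseteq> ball_compl \<epsilon> P"
      by (auto simp: ball_compl_def)
    then have "measure \<nu> F \<le> measure \<nu> (ball_compl \<epsilon> P)"
      by (rule finite_measure_mono) (simp add: \<nu> sets_psd_borel_ball_compl)
    then show ?thesis
      using tail by (simp add: add_increasing)
  qed
  then have S: "\<epsilon> \<in> ?S"
    using \<open>0 < \<epsilon>\<close> by blast
  have "bdd_below ?S"
    by (rule bdd_belowI[of _ 0]) auto
  with S show "prohorov_dist \<nu> (return psd_borel P) \<le> \<epsilon>"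
    unfolding prohorov_dist_def by (rule cInf_lower)
  show "0 \<le> prohorov_dist \<nu> (return psd_borel P)"
    unfolding prohorov_dist_def using S by (intro cInf_greatest) auto
qed

text \<open>Dividing by the negative number \<open>ln (1 - g)\<close> reverses the bound on
  \<open>ln (m g)\<close>: the ratio is at least 1 + ln K / ln (1 - g), which tends to 1.\<close>

lemma Limsup_log_rate:
  fixes m :: "real \<Rightarrow> real"
  assumes K: "0 < K" and m: "\<And>g. 0 < g \<Longrightarrow> g < 1 \<Longrightarrow> m g \<le> K * (1 - g)" "\<And>g. 0 \<le> m g"
  shows "Limsup (at_left 1) (\<lambda>g. - (eln (m g) / ereal (ln (1 - g)))) \<le> -1"
proof -
  let ?h = "\<lambda>g. - ((ln K + ln (1 - g)) / ln (1 - g))"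
  have ev: "eventually (\<lambda>g. 0 < g \<and> g < (1 :: real)) (at_left 1)"
    using eventually_at_left_real[of 0 1] by (simp add: eventually_mono)
  have "eventually (\<lambda>g. - (eln (m g) / ereal (ln (1 - g))) \<le> ereal (?h g)) (at_left 1)"
    using ev
  proof eventually_elim
    case (elim g)
    then have neg: "ln (1 - g) < 0"
      by simp
    show ?case
    proof (cases "m g = 0")
      \<comment> \<open>Here \<open>eln\<close> gives -\<infinity>; division by a negative number
        and the outer minus sign lead back to -\<infinity>.\<close>
      case True
      then show ?thesis
        using neg by (simp add: eln_def)
    next
      case False
      then have "0 < m g"
        using m(2)[of g] by simp
      then have "ln (m g) \<le> ln (K * (1 - g))"
        using m(1)[of g] elim K by (subst ln_le_cancel_iff) auto
      also have "\<dots> = ln K + ln (1 - g)"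
        using K elim by (simp add: ln_mult)
      finally have "(ln K + ln (1 - g)) / ln (1 - g) \<le> ln (m g) / ln (1 - g)"
        using neg by (intro divide_right_mono_neg) auto
      then show ?thesis
        using False neg by (simp add: eln_def)
    qed
  qed
  then have "Limsup (at_left 1) (\<lambda>g. - (eln (m g) / ereal (ln (1 - g))))
    \<le> Limsup (at_left 1) (\<lambda>g. ereal (?h g))"
    by (rule Limsup_mono)
  also have "\<dots> = -1"
  proof -
    have "(?h \<longlongrightarrow> -1) (at_left 1)"
      by real_asymp
    then have "((\<lambda>g. ereal (?h g)) \<longlongrightarrow> ereal (-1)) (at_left 1)"
      by (rule tendsto_ereal)
    then show ?thesis
      by (subst lim_imp_Limsup) (auto simp: one_ereal_def)
  qed
  finally show ?thesis .
qed

theorem mainTheorem3: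
  fixes A Q Pstar :: "real^'n^'n"
    and C :: "real^'n^'m"
    and R :: "real^'m^'m"
    and \<mu> :: "real \<Rightarrow> (real^'n^'n) measure"
  assumes "observable C A"
    and "pos_def Q"
    and "pos_def R"
    and "Pstar \<in> psd_cone"
    and "f1 A C Q R Pstar = Pstar"
    and "\<And>g. 0 < g \<Longrightarrow> g < 1 \<Longrightarrow> invariant_distribution A C Q R g (\<mu> g)"
  shows "((\<lambda>g. prohorov_dist (\<mu> g) (return psd_borel Pstar)) \<longlongrightarrow> 0) (at_left 1) \<and>
    (\<forall>\<epsilon>>0. Limsup (at_left 1)
       (\<lambda>g. - (eln (measure (\<mu> g) (ball_compl \<epsilon> Pstar)) / ereal (ln (1 - g)))) \<le> -1)"
proof (intro conjI allI impI)
  show "((\<lambda>g. prohorov_dist (\<mu> g) (return psd_borel Pstar)) \<longlongrightarrow> 0) (at_left 1)"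
  proof (rule tendstoI)
    fix r :: real
    assume "0 < r"
    then have "0 < r / 2" by simp
    then obtain K where K: "0 < K" "\<And>g \<nu>. 0 < g \<Longrightarrow> g < 1 \<Longrightarrow> invariant_distribution A C Q R g \<nu> \<Longrightarrow>
        measure \<nu> (ball_compl (r / 2) Pstar) \<le> K * (1 - g)"
      using invariant_distribution_ball_compl_tail[OF assms(1-5)] by blast
    \<comment> \<open>Above this threshold \<open>K * (1 - g)\<close> is at most
      \<open>r / 2\<close>, which leaves room for the strict inequality; the maximum keeps
      \<open>g\<close> positive.\<close>
    have "max 0 (1 - r / (2 * K)) < 1"
      using K(1) \<open>0 < r\<close> by simp
    then have "eventually (\<lambda>g. g \<in> {max 0 (1 - r / (2 * K))<..<1}) (at_left 1)"
      by (rule eventually_at_left_real)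
    then show "eventually (\<lambda>g. dist (prohorov_dist (\<mu> g) (return psd_borel Pstar)) 0 < r) (at_left 1)"
    proof eventually_elim
      case (elim g)
      then have g: "0 < g" "g < 1" and "K * (1 - g) \<le> r / 2"
        using K(1) by (auto simp: field_simps)
      then have "measure (\<mu> g) (ball_compl (r / 2) Pstar) \<le> r / 2"
        using K(2)[OF g assms(6)[OF g]] by linarith
      moreover have "prob_space (\<mu> g)" "sets (\<mu> g) = sets psd_borel"
        using assms(6)[OF g] by (auto simp: invariant_distribution_def)
      ultimately have "0 \<le> prohorov_dist (\<mu> g) (return psd_borel Pstar)"
        "prohorov_dist (\<mu> g) (return psd_borel Pstar) \<le> r / 2"
        using prohorov_dist_dirac_bounds[of "\<mu> g" Pstar "r / 2"] assms(4) \<open>0 < r / 2\<close> by auto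
      then show ?case
        using \<open>0 < r\<close> by simp
    qed
  qed
next
  fix \<epsilon> :: real
  assume "0 < \<epsilon>"
  then obtain K where "0 < K" "\<And>g \<nu>. 0 < g \<Longrightarrow> g < 1 \<Longrightarrow> invariant_distribution A C Q R g \<nu> \<Longrightarrow>
      measure \<nu> (ball_compl \<epsilon> Pstar) \<le> K * (1 - g)"
    using invariant_distribution_ball_compl_tail[OF assms(1-5)] by blast
  then show "Limsup (at_left 1)
      (\<lambda>g. - (eln (measure (\<mu> g) (ball_compl \<epsilon> Pstar)) / ereal (ln (1 - g)))) \<le> -1"
    using assms(6) by (intro Limsup_log_rate) auto
qed

end
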